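(* Let $\mathcal{S}\subset\mathbb{T}$ be a measurable set of positive Lebesgue measure. Then there exists a set $\Lambda\subset\mathbb{Z}$ such that: (i) there is a constant $C>0$ such that for arbitrarily large $N\in\mathbb{N}$, $\Lambda$ contains an arithmetic progression $\{M+\ell,M+2\ell,\ldots,M+N\ell\}$ of length $N$ (with some $M\in\mathbb{Z}$) whose step $\ell\in\mathbb{N}$ satisfies $\ell\le CN$; and (ii) $E(\Lambda)=\{e^{i\lambda t}\}_{\lambda\in\Lambda}$ is a Riesz sequence in $L^2(\mathcal{S})$.
   Context: $\mathbb{T}=\mathbb{R}/2\pi\mathbb{Z}$, identified with $[-\pi,\pi)$. For $\Lambda\subset\mathbb{Z}$, $E(\Lambda):=\{e^{i\lambda t}\}_{\lambda\in\Lambda}$. A sequence $\{\varphi_i\}_{i\in I}$ in a Hilbert space is a Riesz sequence if there are constants $A,B>0$ such that $A\sum_{i}|c_i|^2\le \|\sum_i c_i\varphi_i\|^2\le B\sum_i|c_i|^2$ for every finite sequence of scalars $\{c_i\}$. The space $L^2(\mathcal{S})$ is taken with the norm $\|f\|^2=\int_{\mathcal{S}}|f(t)|^2\,\frac{dt}{2\pi}$. *)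

theory Defs
  imports "HOL-Analysis.Analysis"
begin

text \<open>Squared norm in L^2(S) with normalised measure dt/(2 pi), S a subset of [-pi,pi).\<close>
definition L2S_norm_sq :: "real set \<Rightarrow> (real \<Rightarrow> complex) \<Rightarrow> real" where
  "L2S_norm_sq S f = (LINT t:S|lebesgue. (cmod (f t))\<^sup>2) / (2 * pi)"

definition exp_riesz_sequence :: "real set \<Rightarrow> int set \<Rightarrow> bool" where
  "exp_riesz_sequence S \<Lambda> \<longleftrightarrow>
    (\<exists>A B. A > 0 \<and> B > 0 \<and>
      (\<forall>F (c :: int \<Rightarrow> complex). finite F \<and> F \<subseteq> \<Lambda> \<longrightarrow>
         A * (\<Sum>m\<in>F. (cmod (c m))\<^sup>2)
           \<le> L2S_norm_sq S (\<lambda>t. \<Sum>m\<in>F. c m * exp (\<i> * complex_of_real (of_int m * t)))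
         \<and> L2S_norm_sq S (\<lambda>t. \<Sum>m\<in>F. c m * exp (\<i> * complex_of_real (of_int m * t)))
           \<le> B * (\<Sum>m\<in>F. (cmod (c m))\<^sup>2)))"

end

theory Submission
  imports Defs "HOL-Computational_Algebra.Squarefree"
begin

text \<open>
  Let \<open>a m\<close> be the modulus of the \<open>m\<close>-th Fourier coefficient of the indicator function of \<open>S\<close> and
  \<open>d = a 0 > 0\<close>. The Gram matrix of \<open>E(\<Lambda>)\<close> in \<open>L\<^sup>2(S)\<close> has diagonal entries \<open>d\<close> and off-diagonal
  entries of modulus \<open>a (m - n)\<close>, so by Schur's test it suffices that all off-diagonal row sums stay
  below \<open>d / 2\<close>.

  An integer has at most one representation \<open>n p\<close> with \<open>p\<close> prime and \<open>1 \<le> n < p\<close>. Hence, by Bessel's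
  inequality, \<open>V p = (\<Sum>n<p. (a (n p))\<^sup>2)\<close> has a finite sum over the primes, whereas \<open>\<Sum> 1/p\<close> diverges;
  so \<open>p V p\<close> is arbitrarily small for infinitely many primes \<open>p\<close>. For such \<open>p\<close>, Cauchy--Schwarz makes
  the row sums of the progression \<open>p, 2p, \<dots>, p p\<close> small. As \<open>a\<close> tends to \<open>0\<close>, translating
  these progressions successively far apart keeps every row sum strictly below \<open>d / 2\<close>.
\<close>

subsection \<open>Divergence of the sum of prime reciprocals\<close>

lemma card_multiples_le:
  assumes "p > 0"
  shows "real (card {m\<in>{1..n}. p dvd m}) \<le> real n / real p"
proof -
  have "{m\<in>{1..n}. p dvd m} \<subseteq> (\<lambda>k. p * k) ` {1..n div p}"
  proof
    fix m assume m: "m \<in> {m\<in>{1..n}. p dvd m}"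
    then obtain k where k: "m = p * k" by auto
    have "k \<le> n div p" using m assms unfolding k by (simp add: less_eq_div_iff_mult_less_eq mult.commute)
    moreover have "k \<ge> 1" using m k by (cases k) auto
    ultimately show "m \<in> (\<lambda>k. p * k) ` {1..n div p}" using k by auto
  qed
  hence "card {m\<in>{1..n}. p dvd m} \<le> card ((\<lambda>k. p * k) ` {1..n div p})"
    by (intro card_mono) auto
  also have "\<dots> \<le> n div p" using card_image_le[of "{1..n div p}" "\<lambda>k. p * k"] by simp
  finally have "real (card {m\<in>{1..n}. p dvd m}) \<le> real (n div p)" by simp
  also have "\<dots> \<le> real n / real p" by (simp add: of_nat_div_le_of_nat)
  finally show ?thesis .
qed

text \<open>Write \<open>m\<close> as a square times a squarefree number. The root of the square is
  at most \<open>s\<close>, and the squarefree part is the product of its set of prime divisors, a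
  subset of \<open>{..<K}\<close>; so \<open>m\<close> is determined by one of at most
  \<open>s * 2 ^ K\<close> pairs.\<close>

lemma card_smooth_le:
  "card {m\<in>{1..s\<^sup>2}. \<forall>p. prime p \<longrightarrow> p dvd m \<longrightarrow> p < K} \<le> s * 2 ^ K"
proof -
  let ?A = "{m\<in>{1..s\<^sup>2}. \<forall>p. prime p \<longrightarrow> p dvd m \<longrightarrow> p < (K::nat)}"
  let ?f = "\<lambda>(a, P). a\<^sup>2 * \<Prod>P :: nat"
  have "?A \<subseteq> ?f ` ({1..s} \<times> Pow {..<K})"
  proof
    fix m assume m: "m \<in> ?A"
    define P where "P = prime_factors (squarefree_part m)"
    have m0: "m \<noteq> 0" using m by auto
    have sq: "squarefree (squarefree_part m)" using m0 by auto
    have "squarefree_part m = (\<Prod>p\<in>P. p ^ multiplicity p (squarefree_part m))"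
      unfolding P_def using m0 by (subst prod_prime_factors) auto
    also have "\<dots> = \<Prod>P"
      using sq squarefree_factorial_semiring'[of "squarefree_part m"]
      by (intro prod.cong) (simp_all add: P_def)
    finally have "m = ?f (square_part m, P)"
      using squarefree_decompose[of m] by (simp add: mult.commute)
    moreover have "square_part m \<in> {1..s}"
    proof -
      have "(square_part m)\<^sup>2 \<le> m" using m0 by (intro dvd_imp_le) auto
      also have "m \<le> s\<^sup>2" using m by simp
      finally have "square_part m \<le> s" by (simp add: power2_nat_le_eq_le)
      moreover have "square_part m \<noteq> 0" using m0 by simp
      ultimately show ?thesis unfolding atLeastAtMost_iff by linarith
    qed
    moreover have "P \<subseteq> {..<K}"
    proof
      fix p assume p: "p \<in> P"
      hence "prime p" "p dvd squarefree_part m" by (auto simp: P_def)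
      moreover have "squarefree_part m dvd m"
        by (rule dvdI, rule squarefree_decompose)
      ultimately show "p \<in> {..<K}" using m by (auto dest: dvd_trans)
    qed
    ultimately show "m \<in> ?f ` ({1..s} \<times> Pow {..<K})" by blast
  qed
  hence "card ?A \<le> card (?f ` ({1..s} \<times> Pow {..<K}))" by (intro card_mono) auto
  also have "\<dots> \<le> card ({1..s} \<times> Pow {..<K})" by (intro card_image_le) auto
  also have "\<dots> = s * 2 ^ K" by (simp add: card_cartesian_product card_Pow)
  finally show ?thesis .
qed

text \<open>Erdos' argument: at most \<open>s 2^K\<close> of the numbers up to \<open>s\<^sup>2\<close> have no prime factor \<open>\<ge> K\<close>,
  while fewer than half of them have one if the tail of the series beyond \<open>K\<close> is below \<open>1/2\<close>.\<close>

theorem prime_reciprocals_not_summable: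
  "\<not> summable (\<lambda>p::nat. if prime p then 1 / real p else 0)"
proof
  let ?f = "\<lambda>p::nat. if prime p then 1 / real p else 0"
  assume "summable ?f"
  then obtain K where K: "\<And>n. norm (\<Sum>p=K..<n. ?f p) < 1 / 2"
    unfolding summable_Cauchy by (metis half_gt_zero zero_less_one order_refl)
  \<comment> \<open>With this \<open>s\<close>, the bound \<open>s * 2 ^ K\<close> on the numbers
    without large prime factors is exactly half of \<open>n\<close>.\<close>
  define s :: nat where "s = 2 ^ Suc K"
  define n where "n = s\<^sup>2"
  let ?A = "{m\<in>{1..n}. \<forall>p. prime p \<longrightarrow> p dvd m \<longrightarrow> p < K}"
  let ?B = "\<lambda>p. {m\<in>{1..n}. p dvd m}"
  let ?Q = "{p\<in>{K..<Suc n}. prime p}"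
  have "{1..n} \<subseteq> ?A \<union> (\<Union>p\<in>?Q. ?B p)"
  proof
    fix m assume m: "m \<in> {1..n}"
    show "m \<in> ?A \<union> (\<Union>p\<in>?Q. ?B p)"
    proof (cases "m \<in> ?A")
      case False
      then obtain p where p: "prime p" "p dvd m" "\<not> p < K" using m by auto
      have "p \<le> n" using dvd_imp_le[OF p(2)] m by auto
      thus ?thesis using p m by auto
    qed auto
  qed
  hence "card {1..n} \<le> card (?A \<union> (\<Union>p\<in>?Q. ?B p))" by (intro card_mono) auto
  also have "\<dots> \<le> card ?A + card (\<Union>p\<in>?Q. ?B p)" by (rule card_Un_le)
  also have "card (\<Union>p\<in>?Q. ?B p) \<le> (\<Sum>p\<in>?Q. card (?B p))" by (intro card_UN_le) auto
  finally have "real n \<le> real (card ?A) + (\<Sum>p\<in>?Q. real (card (?B p)))"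
    by (simp add: of_nat_sum [symmetric] del: of_nat_sum)
  moreover have "(\<Sum>p\<in>?Q. real (card (?B p))) \<le> (\<Sum>p\<in>?Q. real n / real p)"
    by (intro sum_mono card_multiples_le) (auto simp: prime_gt_0_nat)
  moreover have "(\<Sum>p\<in>?Q. real n / real p) = real n * (\<Sum>p=K..<Suc n. ?f p)"
    unfolding sum_distrib_left by (subst sum.inter_filter) (auto intro!: sum.cong simp del: sum.op_ivl_Suc)
  moreover have "real n * (\<Sum>p=K..<Suc n. ?f p) < real n * (1 / 2)"
    using K[of "Suc n"] by (intro mult_strict_left_mono) (auto simp: n_def s_def)
  moreover have "real (card ?A) \<le> real (s * 2 ^ K)"
    unfolding n_def of_nat_le_iff by (rule card_smooth_le)
  moreover have "real (s * 2 ^ K) = real n / 2"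
    by (simp add: n_def s_def power2_eq_square)
  ultimately show False by linarith
qed

section \<open>Square sums along multiples of primes\<close>

text \<open>If \<open>n * p = m * q\<close> with distinct primes \<open>p < q\<close>, then
  \<open>q\<close> divides \<open>n\<close>, which is impossible for
  \<open>1 \<le> n < p < q\<close>.\<close>

lemma inj_on_prime_multiples:
  "inj_on (\<lambda>(p, n). n * p) (SIGMA p:{p::nat. prime p}. {1..<p})"
proof -
  have *: "p = q" if "prime p" "prime q" "n * p = m * q" "n \<in> {1..<p}" "m \<in> {1..<q}" "p \<le> q"
    for p q n m :: nat
  proof (rule ccontr)
    assume "p \<noteq> q"
    have "q dvd n * p" using that by simp
    hence "q dvd n" using that \<open>p \<noteq> q\<close> by (metis prime_dvd_mult_iff primes_dvd_imp_eq)
    hence "q \<le> n" using that by (intro dvd_imp_le) auto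
    thus False using that by simp
  qed
  show ?thesis
  proof (rule inj_onI, clarify)
    fix p q n m :: nat
    assume h: "prime p" "prime q" "n * p = m * q" "n \<in> {1..<p}" "m \<in> {1..<q}"
    hence "p = q" using *[of p q n m] *[of q p m n] by (cases "p \<le> q") auto
    thus "p = q \<and> n = m" using h by auto
  qed
qed

text \<open>Otherwise \<open>1 / p \<le> V p / e\<close> for every prime \<open>p \<ge> K\<close>.
  The sets of multiples defining the \<open>V p\<close> are disjoint for distinct primes, so the
  bound \<open>B\<close> on square sums makes the series of the \<open>V p\<close> converge, and
  with it that of the prime reciprocals.\<close>

lemma exists_prime_small_energy:
  fixes a :: "nat \<Rightarrow> real"
  assumes bd: "\<And>F. finite F \<Longrightarrow> (\<Sum>m\<in>F. (a m)\<^sup>2) \<le> B" and "e > 0"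
  shows "\<exists>p\<ge>K. prime p \<and> real p * (\<Sum>n=1..<p. (a (n * p))\<^sup>2) < e"
proof (rule ccontr)
  assume neg: "\<not> ?thesis"
  define V where "V = (\<lambda>p. \<Sum>n=1..<p. (a (n * p))\<^sup>2)"
  let ?g = "\<lambda>p::nat. if prime p then V p else 0"
  have "summable ?g"
  proof (rule summableI_nonneg_bounded)
    fix N :: nat
    let ?Q = "{p\<in>{..<N}. prime p}"
    let ?I = "SIGMA p:?Q. {1..<p}"
    have "(\<Sum>p<N. ?g p) = (\<Sum>p\<in>?Q. V p)" by (subst sum.inter_filter) auto
    also have "\<dots> = (\<Sum>(p, n)\<in>?I. (a (n * p))\<^sup>2)"
      unfolding V_def by (subst sum.Sigma) auto
    also have "\<dots> = (\<Sum>m\<in>(\<lambda>(p, n). n * p) ` ?I. (a m)\<^sup>2)"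
    proof -
      have "inj_on (\<lambda>(p, n). n * p) ?I"
        by (rule inj_on_subset[OF inj_on_prime_multiples]) auto
      thus ?thesis by (simp add: sum.reindex case_prod_unfold)
    qed
    also have "\<dots> \<le> B" by (intro bd) auto
    finally show "(\<Sum>p<N. ?g p) \<le> B" .
  qed (auto simp: V_def intro: sum_nonneg)
  hence "summable (\<lambda>p. ?g p / e)" by (rule summable_divide)
  moreover have "norm (if prime p then 1 / real p else 0) \<le> ?g p / e" if "p \<ge> K" for p
  proof (cases "prime p")
    case True
    hence "e \<le> real p * V p" using neg that by (auto simp: V_def not_less)
    thus ?thesis using True \<open>e > 0\<close> prime_gt_0_nat[OF True] by (simp add: field_simps)
  qed auto
  ultimately have "summable (\<lambda>p::nat. if prime p then 1 / real p else 0)"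
    by (rule summable_comparison_test')
  thus False using prime_reciprocals_not_summable by contradiction
qed

subsection \<open>Gluing progressions\<close>

text \<open>Off-diagonal row sums of the Toeplitz matrix \<open>a (m - n)\<close> indexed by \<open>F\<close>.\<close>

definition rows_below :: "(int \<Rightarrow> real) \<Rightarrow> real \<Rightarrow> int set \<Rightarrow> bool" where
  "rows_below a h F \<longleftrightarrow> (\<forall>m\<in>F. (\<Sum>n\<in>F - {m}. a (m - n)) < h)"

lemma rows_below_subset:
  assumes "rows_below a h G" "F \<subseteq> G" "finite G" "\<And>m. a m \<ge> 0"
  shows "rows_below a h F"
  unfolding rows_below_def
proof
  fix m assume "m \<in> F"
  have "(\<Sum>n\<in>F - {m}. a (m - n)) \<le> (\<Sum>n\<in>G - {m}. a (m - n))"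
    using assms by (intro sum_mono2) auto
  also have "\<dots> < h" using assms \<open>m \<in> F\<close> unfolding rows_below_def by auto
  finally show "(\<Sum>n\<in>F - {m}. a (m - n)) < h" .
qed

text \<open>Points common to \<open>F\<close> and \<open>G\<close> are counted twice on the right,
  and \<open>m\<close> itself may be counted in \<open>G\<close>; as \<open>a\<close> is
  nonnegative, this only enlarges the bound.\<close>

lemma sum_offdiagonal_Un_le:
  fixes a :: "int \<Rightarrow> real"
  assumes "finite F" "finite G" "\<And>m. a m \<ge> 0"
  shows "(\<Sum>n\<in>(F \<union> G) - {m}. a (m - n)) \<le> (\<Sum>n\<in>F - {m}. a (m - n)) + (\<Sum>n\<in>G. a (m - n))"
proof -
  have "(\<Sum>n\<in>(F \<union> G) - {m}. a (m - n)) \<le> (\<Sum>n\<in>(F - {m}) \<union> G. a (m - n))"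
    using assms by (intro sum_mono2) auto
  also have "\<dots> \<le> (\<Sum>n\<in>F - {m}. a (m - n)) + (\<Sum>n\<in>G. a (m - n))"
    using assms sum.union_inter[of "F - {m}" G "\<lambda>n. a (m - n)"]
      sum_nonneg[of "(F - {m}) \<inter> G" "\<lambda>n. a (m - n)"] by simp
  finally show ?thesis .
qed

text \<open>Translation leaves the differences within \<open>P\<close> unchanged, while those
  between \<open>F\<close> and the translate tend to infinity with \<open>M\<close>. Each row thus
  gains a finite sum tending to 0, and finitely many strict inequalities survive for large
  \<open>M\<close>.\<close>

lemma rows_below_Un_translate:
  fixes a :: "int \<Rightarrow> real"
  assumes nn: "\<And>m. a m \<ge> 0" and even: "\<And>m. a (- m) = a m"
    and lim: "(a \<longlongrightarrow> 0) at_top"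
    and F: "finite F" "rows_below a h F" and P: "finite P" "rows_below a h P"
  shows "\<exists>M. rows_below a h (F \<union> (+) M ` P)"
proof -
  \<comment> \<open>By evenness all cross terms take the form \<open>a (M + c)\<close>, so the limit
    at plus infinity covers both signs of the difference.\<close>
  have even_diff: "a (m - (M + q)) = a (M + (q - m))" for m M q
    using even[of "M + (q - m)"] by (simp add: algebra_simps)
  have shift: "((\<lambda>M. a (M + c)) \<longlongrightarrow> 0) at_top" for c
  proof -
    have "filterlim (\<lambda>M::int. M + c) at_top at_top"
      unfolding filterlim_at_top
    proof
      fix Z show "\<forall>\<^sub>F M in at_top. Z \<le> M + c"
        by (rule eventually_at_top_linorderI[of "Z - c"]) auto
    qed
    thus ?thesis using lim by (rule filterlim_compose[rotated])
  qed
  \<comment> \<open>The strict bound in \<open>rows_below\<close> leaves the room that absorbs the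
    new terms.\<close>
  have far: "\<forall>\<^sub>F M in at_top. s + (\<Sum>x\<in>X. a (M + c x)) < h"
    if "s < h" for s and X :: "int set" and c
  proof -
    have "((\<lambda>M. s + (\<Sum>x\<in>X. a (M + c x))) \<longlongrightarrow> s + (\<Sum>x\<in>X. 0)) at_top"
      by (intro tendsto_intros shift)
    thus ?thesis using that by (intro order_tendstoD(2)) auto
  qed
  have "\<forall>\<^sub>F M in at_top. \<forall>m\<in>F. (\<Sum>n\<in>F - {m}. a (m - n)) + (\<Sum>q\<in>P. a (M + (q - m))) < h"
    using F by (intro eventually_ball_finite ballI far) (auto simp: rows_below_def)
  moreover have "\<forall>\<^sub>F M in at_top. \<forall>p\<in>P. (\<Sum>q\<in>P - {p}. a (p - q)) + (\<Sum>n\<in>F. a (M + (p - n))) < h"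
    using P by (intro eventually_ball_finite ballI far) (auto simp: rows_below_def)
  ultimately have "\<forall>\<^sub>F M in at_top. rows_below a h (F \<union> (+) M ` P)"
  proof eventually_elim
    case (elim M)
    show ?case unfolding rows_below_def
    proof (rule ballI, elim UnE imageE)
      fix m assume m: "m \<in> F"
      have "(\<Sum>n\<in>(+) M ` P. a (m - n)) = (\<Sum>q\<in>P. a (M + (q - m)))"
        by (subst sum.reindex) (auto intro!: sum.cong simp: even_diff)
      thus "(\<Sum>n\<in>F \<union> (+) M ` P - {m}. a (m - n)) < h"
        using elim(1) m sum_offdiagonal_Un_le[of F "(+) M ` P" a m] F P nn by fastforce
    next
      fix m p assume p: "p \<in> P" and m: "m = M + p"
      have "(\<Sum>n\<in>(+) M ` P - {m}. a (m - n)) = (\<Sum>n\<in>(+) M ` (P - {p}). a (m - n))"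
        by (intro sum.cong) (auto simp: m)
      also have "\<dots> = (\<Sum>q\<in>P - {p}. a (p - q))"
        by (subst sum.reindex) (auto intro!: sum.cong simp: m)
      finally have "(\<Sum>n\<in>(+) M ` P - {m}. a (m - n)) = (\<Sum>q\<in>P - {p}. a (p - q))" .
      moreover have "(\<Sum>n\<in>F. a (m - n)) = (\<Sum>n\<in>F. a (M + (p - n)))"
        by (simp add: m algebra_simps)
      ultimately show "(\<Sum>n\<in>F \<union> (+) M ` P - {m}. a (m - n)) < h"
        using elim(2) p sum_offdiagonal_Un_le[of "(+) M ` P" F a m] F P nn
        by (fastforce simp: Un_commute)
    qed
  qed
  thus ?thesis by (rule eventually_happens'[rotated]) auto
qed

lemma tendsto_0_if_square_sums_bounded:
  fixes a :: "int \<Rightarrow> real"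
  assumes "\<And>F. finite F \<Longrightarrow> (\<Sum>m\<in>F. (a m)\<^sup>2) \<le> B"
  shows "(a \<longlongrightarrow> 0) at_top"
proof -
  have "summable (\<lambda>n. (a (int n))\<^sup>2)"
  proof (rule summableI_nonneg_bounded)
    fix n
    have "(\<Sum>i<n. (a (int i))\<^sup>2) = (\<Sum>m\<in>int ` {..<n}. (a m)\<^sup>2)"
      by (subst sum.reindex) auto
    thus "(\<Sum>i<n. (a (int i))\<^sup>2) \<le> B" using assms[of "int ` {..<n}"] by simp
  qed auto
  hence "(\<lambda>n. (a (int n))\<^sup>2) \<longlonglongrightarrow> 0" by (rule summable_LIMSEQ_zero)
  hence "(\<lambda>n. sqrt ((a (int n))\<^sup>2)) \<longlonglongrightarrow> sqrt 0" by (rule tendsto_real_sqrt)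
  hence "(\<lambda>n. a (int n)) \<longlonglongrightarrow> 0" by (simp add: tendsto_rabs_zero_iff)
  hence "((\<lambda>m. a (int (nat m))) \<longlongrightarrow> 0) at_top"
    using filterlim_nat_sequentially by (rule filterlim_compose)
  thus ?thesis
    by (rule Lim_transform_eventually)
       (auto intro: eventually_at_top_linorderI[of 0])
qed

section \<open>Progressions of prime step and length\<close>

text \<open>Take a prime \<open>p\<close> as both step and length. The nonzero differences are then
  \<open>n * p\<close> up to sign with \<open>1 \<le> n < p\<close>, each occurring at most twice in
  a row, so a row sum is at most \<open>2 * s\<close>. Cauchy-Schwarz bounds
  \<open>s\<^sup>2\<close> by \<open>p\<close> times the square sum over these multiples.\<close>

lemma exists_progression_rows_below:
  fixes a :: "int \<Rightarrow> real"
  assumes nn: "\<And>m. a m \<ge> 0" and even: "\<And>m. a (- m) = a m"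
    and bd: "\<And>F. finite F \<Longrightarrow> (\<Sum>m\<in>F. (a m)\<^sup>2) \<le> B" and "h > 0"
  shows "\<exists>N\<ge>K. N \<ge> 1 \<and> rows_below a h {int k * int N | k. k \<in> {1..N}}"
proof -
  \<comment> \<open>The threshold is \<open>(h / 2)\<^sup>2\<close> because a row has a left and a
    right half, each of which must stay below \<open>h / 2\<close>.\<close>
  have "\<exists>p\<ge>K. prime p \<and> real p * (\<Sum>n=1..<p. (a (int (n * p)))\<^sup>2) < (h / 2)\<^sup>2"
  proof (rule exists_prime_small_energy)
    fix F :: "nat set" assume "finite F"
    have "(\<Sum>m\<in>F. (a (int m))\<^sup>2) = (\<Sum>m\<in>int ` F. (a m)\<^sup>2)" by (subst sum.reindex) auto
    thus "(\<Sum>m\<in>F. (a (int m))\<^sup>2) \<le> B" using bd[of "int ` F"] \<open>finite F\<close> by simp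
  qed (use \<open>h > 0\<close> in auto)
  then obtain p where p: "p \<ge> K" "prime p"
    and V: "real p * (\<Sum>n=1..<p. (a (int (n * p)))\<^sup>2) < (h / 2)\<^sup>2" by blast
  define s where "s = (\<Sum>n=1..<p. a (int (n * p)))"
  have "s\<^sup>2 \<le> (\<Sum>n=1..<p. 1\<^sup>2) * (\<Sum>n=1..<p. (a (int (n * p)))\<^sup>2)"
    using Cauchy_Schwarz_ineq_sum[of "\<lambda>_. 1" "\<lambda>n. a (int (n * p))" "{1..<p}"] by (simp add: s_def)
  also have "\<dots> \<le> real p * (\<Sum>n=1..<p. (a (int (n * p)))\<^sup>2)"
    by (intro mult_right_mono sum_nonneg) auto
  also note V
  finally have s: "s < h / 2" using \<open>h > 0\<close> by (intro power2_less_imp_less[of s "h / 2"]) simp_all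
  have "rows_below a h {int k * int p | k. k \<in> {1..p}}"
    unfolding rows_below_def
  proof (clarify)
    fix k assume k: "k \<in> {1..p}"
    have p0: "p > 0" using p by (simp add: prime_gt_0_nat)
    \<comment> \<open>These are the points to the left and to the right of the \<open>k\<close>-th
      one. \<open>?R\<close> may run past the end of the progression, which only adds nonnegative
      terms and makes its sum equal to \<open>s\<close> for every \<open>k\<close>.\<close>
    let ?L = "(\<lambda>n. int (k - n) * int p) ` {1..<k}"
    let ?R = "(\<lambda>n. int (k + n) * int p) ` {1..<p}"
    have "{int j * int p | j. j \<in> {1..p}} - {int k * int p} \<subseteq> ?L \<union> ?R"
    proof clarify
      fix j assume j: "j \<in> {1..p}" "int j * int p \<notin> ?R" "int j * int p \<noteq> int k * int p"
      show "int j * int p \<in> ?L"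
      proof (cases "j < k")
        case True
        show ?thesis by (rule image_eqI[of _ _ "k - j"]) (use True j k in auto)
      next
        case False
        have "int j * int p \<in> ?R"
          by (rule image_eqI[of _ _ "j - k"]) (use False j k in \<open>auto simp: not_less order.order_iff_strict\<close>)
        thus ?thesis using j by blast
      qed
    qed
    hence "(\<Sum>n\<in>{int j * int p | j. j \<in> {1..p}} - {int k * int p}. a (int k * int p - n))
         \<le> (\<Sum>n\<in>?L \<union> ?R. a (int k * int p - n))"
      by (intro sum_mono2 nn) auto
    also have "\<dots> \<le> (\<Sum>n\<in>?L. a (int k * int p - n)) + (\<Sum>n\<in>?R. a (int k * int p - n))"
      using sum.union_inter[of ?L ?R "\<lambda>n. a (int k * int p - n)"]
        sum_nonneg[of "?L \<inter> ?R" "\<lambda>n. a (int k * int p - n)"] nn by simp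
    also have "(\<Sum>n\<in>?L. a (int k * int p - n)) = (\<Sum>n=1..<k. a (int (n * p)))"
      using p0 by (subst sum.reindex)
        (auto intro!: sum.cong inj_onI simp: of_nat_diff algebra_simps)
    also have "\<dots> \<le> s" unfolding s_def using k by (intro sum_mono2 nn) auto
    also have "(\<Sum>n\<in>?R. a (int k * int p - n)) = s"
      unfolding s_def using p0 by (subst sum.reindex)
        (auto intro!: sum.cong inj_onI simp: even algebra_simps)
    finally show "(\<Sum>n\<in>{int j * int p | j. j \<in> {1..p}} - {int k * int p}. a (int k * int p - n)) < h"
      using s by linarith
  qed
  thus ?thesis using p prime_ge_1_nat by blast
qed

text \<open>Stage \<open>n\<close> of an increasing chain of finite sets glues on a progression of
  length at least \<open>n\<close>. A finite subset of the union already lies in one stage and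
  inherits the row bound from it.\<close>

lemma exists_spectrum_rows_below:
  fixes a :: "int \<Rightarrow> real"
  assumes nn: "\<And>m. a m \<ge> 0" and even: "\<And>m. a (- m) = a m"
    and bd: "\<And>F. finite F \<Longrightarrow> (\<Sum>m\<in>F. (a m)\<^sup>2) \<le> B" and "h > 0"
  shows "\<exists>\<Lambda>. (\<forall>K. \<exists>N\<ge>K. N \<ge> 1 \<and> (\<exists>M. {M + int k * int N | k. k \<in> {1..N}} \<subseteq> \<Lambda>))
            \<and> (\<forall>F. finite F \<and> F \<subseteq> \<Lambda> \<longrightarrow> rows_below a h F)"
proof -
  let ?Q = "\<lambda>n F G. F \<subseteq> G \<and> (\<exists>N\<ge>n. N \<ge> 1 \<and> (\<exists>M. {M + int k * int N | k. k \<in> {1..N}} \<subseteq> G))"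
  have "\<exists>f. \<forall>n. (finite (f n) \<and> rows_below a h (f n)) \<and> ?Q n (f n) (f (Suc n))"
  proof (rule dependent_nat_choice)
    show "\<exists>F. finite F \<and> rows_below a h F" by (intro exI[of _ "{}"]) (simp add: rows_below_def)
  next
    fix F :: "int set" and n :: nat
    assume F: "finite F \<and> rows_below a h F"
    obtain N where N: "N \<ge> n" "N \<ge> 1" and P: "rows_below a h {int k * int N | k. k \<in> {1..N}}"
      using exists_progression_rows_below[of a B h n, OF assms] by blast
    let ?P = "{int k * int N | k. k \<in> {1..N}}"
    obtain M where M: "rows_below a h (F \<union> (+) M ` ?P)"
      using rows_below_Un_translate[OF nn even tendsto_0_if_square_sums_bounded[OF bd], of F h ?P] F P by auto
    have "{M + int k * int N | k. k \<in> {1..N}} \<subseteq> F \<union> (+) M ` ?P" by auto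
    thus "\<exists>G. (finite G \<and> rows_below a h G) \<and> ?Q n F G"
      using M N F by (intro exI[of _ "F \<union> (+) M ` ?P"]) auto
  qed
  then obtain f where f: "\<And>n. finite (f n)" "\<And>n. rows_below a h (f n)" "\<And>n. ?Q n (f n) (f (Suc n))"
    by blast
  have "incseq f" using f(3) by (intro incseq_SucI) blast
  show ?thesis
  proof (intro exI[of _ "\<Union>n. f n"] conjI allI impI)
    fix K
    show "\<exists>N\<ge>K. N \<ge> 1 \<and> (\<exists>M. {M + int k * int N | k. k \<in> {1..N}} \<subseteq> (\<Union>n. f n))"
      using f(3)[of K] by (meson UN_upper UNIV_I order_trans)
  next
    fix F assume F: "finite F \<and> F \<subseteq> (\<Union>n. f n)"
    moreover have "subset.chain UNIV (range f)"
    proof -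
      have "f i \<subseteq> f j \<or> f j \<subseteq> f i" for i j
        using \<open>incseq f\<close> nat_le_linear[of i j] by (auto dest: incseqD)
      thus ?thesis unfolding subset_chain_def by blast
    qed
    ultimately obtain G where "F \<subseteq> G" "G \<in> range f"
      by (metis UNIV_not_empty finite_subset_Union_chain image_is_empty)
    then obtain n where "F \<subseteq> f n" by blast
    thus "rows_below a h F" using rows_below_subset[OF f(2) _ f(1) nn] by blast
  qed
qed

section \<open>Schur's test\<close>

text \<open>Bound \<open>x m * x n\<close> by the mean of the two squares; by symmetry of
  \<open>r\<close> both halves contribute the same weighted row sum.\<close>

lemma schur_test_symmetric:
  fixes r :: "'a \<Rightarrow> 'a \<Rightarrow> real"
  assumes sym: "\<And>m n. r m n = r n m" and nn: "\<And>m n. r m n \<ge> 0"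
    and row: "\<And>m. m \<in> F \<Longrightarrow> (\<Sum>n\<in>F. r m n) \<le> h"
  shows "(\<Sum>m\<in>F. \<Sum>n\<in>F. r m n * (x m * x n)) \<le> h * (\<Sum>m\<in>F. (x m)\<^sup>2)"
proof -
  have "(\<Sum>m\<in>F. \<Sum>n\<in>F. r m n * (x m * x n))
      \<le> (\<Sum>m\<in>F. \<Sum>n\<in>F. r m n * ((x m)\<^sup>2 / 2) + r m n * ((x n)\<^sup>2 / 2))"
  proof (intro sum_mono)
    fix m n
    have "x m * x n \<le> (x m)\<^sup>2 / 2 + (x n)\<^sup>2 / 2"
      using sum_squares_bound[of "x m" "x n"] by simp
    thus "r m n * (x m * x n) \<le> r m n * ((x m)\<^sup>2 / 2) + r m n * ((x n)\<^sup>2 / 2)"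
      using nn by (metis distrib_left mult_left_mono)
  qed
  also have "\<dots> = (\<Sum>m\<in>F. \<Sum>n\<in>F. r m n * ((x m)\<^sup>2 / 2)) + (\<Sum>m\<in>F. \<Sum>n\<in>F. r m n * ((x n)\<^sup>2 / 2))"
    by (simp add: sum.distrib)
  also have "(\<Sum>m\<in>F. \<Sum>n\<in>F. r m n * ((x n)\<^sup>2 / 2)) = (\<Sum>m\<in>F. \<Sum>n\<in>F. r m n * ((x m)\<^sup>2 / 2))"
    by (subst sum.swap) (simp add: sym)
  also have "(\<Sum>m\<in>F. \<Sum>n\<in>F. r m n * ((x m)\<^sup>2 / 2)) + (\<Sum>m\<in>F. \<Sum>n\<in>F. r m n * ((x m)\<^sup>2 / 2))
      = (\<Sum>m\<in>F. (\<Sum>n\<in>F. r m n) * (x m)\<^sup>2)"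
    by (simp add: sum_distrib_right flip: sum.distrib)
  also have "\<dots> \<le> (\<Sum>m\<in>F. h * (x m)\<^sup>2)"
    by (intro sum_mono mult_right_mono row) auto
  finally show ?thesis by (simp add: sum_distrib_left)
qed

subsection \<open>Fourier coefficients of indicator functions\<close>

text \<open>The exponent has the opposite sign to the usual convention, so this is the classical
  coefficient at \<open>- m\<close>. In this form the inner product over \<open>S\<close> of the
  exponentials with frequencies \<open>m\<close> and \<open>n\<close> is the value at
  \<open>m - n\<close>.\<close>

definition indicator_fourier :: "real set \<Rightarrow> int \<Rightarrow> complex" where
  "indicator_fourier S m = (LINT t:S|lebesgue. cis (of_int m * t)) / (2 * pi)"

lemma set_integral_sum:
  fixes f :: "'i \<Rightarrow> 'a \<Rightarrow> 'b::{banach, second_countable_topology}"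
  assumes "\<And>i. i \<in> I \<Longrightarrow> set_integrable M A (f i)"
  shows "(LINT t:A|M. (\<Sum>i\<in>I. f i t)) = (\<Sum>i\<in>I. (LINT t:A|M. f i t))"
  using assms unfolding set_integrable_def set_lebesgue_integral_def
  by (simp add: scaleR_sum_right Bochner_Integration.integral_sum)

lemma set_integrable_continuous_bounded_set:
  fixes f :: "real \<Rightarrow> 'a::euclidean_space"
  assumes "S \<in> sets lebesgue" "S \<subseteq> {a..b}" "continuous_on UNIV f"
  shows "set_integrable lebesgue S f"
proof -
  have "continuous_on {a..b} f" using assms(3) by (rule continuous_on_subset) auto
  hence "f absolutely_integrable_on {a..b}" by (rule absolutely_integrable_continuous_real)
  thus ?thesis using assms(1,2) by (rule set_integrable_subset)
qed

lemma indicator_fourier_uminus: "indicator_fourier S (- m) = cnj (indicator_fourier S m)"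
proof -
  have "(LINT t:S|lebesgue. cis (of_int (- m) * t)) = cnj (LINT t:S|lebesgue. cis (of_int m * t))"
    unfolding set_lebesgue_integral_def
    by (subst Bochner_Integration.integral_cnj [symmetric]) (simp add: cis_cnj)
  thus ?thesis by (simp add: indicator_fourier_def)
qed

lemma indicator_fourier_0: "indicator_fourier S 0 = of_real (measure lebesgue S / (2 * pi))"
proof -
  have "(LINT t:S|lebesgue. (1::complex)) = of_real (LINT t:S|lebesgue. (1::real))"
    by (subst set_integral_complex_of_real [symmetric]) simp
  thus ?thesis by (simp add: indicator_fourier_def set_lebesgue_integral_def)
qed

text \<open>This is the orthonormality of the exponentials over a full period: for
  \<open>m \<noteq> 0\<close> the primitive takes equal values at both endpoints.\<close>

lemma indicator_fourier_interval:
  "indicator_fourier {-pi..pi} m = (if m = 0 then 1 else 0)"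
proof (cases "m = 0")
  case False
  have "((\<lambda>t. cis (of_int m * t)) has_integral
      (cis (of_int m * pi) / (\<i> * of_int m) - cis (of_int m * (-pi)) / (\<i> * of_int m))) {-pi..pi}"
  proof (rule fundamental_theorem_of_calculus)
    fix t
    show "((\<lambda>t. cis (of_int m * t) / (\<i> * of_int m)) has_vector_derivative cis (of_int m * t))
        (at t within {-pi..pi})"
    proof -
      have "((\<lambda>z. exp (\<i> * of_int m * z) / (\<i> * of_int m)) has_field_derivative
          exp (\<i> * of_int m * of_real t)) (at (of_real t))"
        using False by (auto intro!: derivative_eq_intros)
      hence "((\<lambda>t. exp (\<i> * of_int m * of_real t) / (\<i> * of_int m)) has_vector_derivative
          exp (\<i> * of_int m * of_real t)) (at t within {-pi..pi})"
        by (rule has_vector_derivative_real_field)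
      thus ?thesis by (simp add: cis_conv_exp o_def mult.assoc)
    qed
  qed auto
  moreover have "cis (of_int m * pi) = cis (of_int m * (-pi))"
    by (simp add: complex_eq_iff sin_zero_iff_int2)
  moreover have "(\<lambda>t. cis (of_int m * t)) absolutely_integrable_on {-pi..pi}"
    by (intro absolutely_integrable_continuous_real continuous_intros)
  ultimately show ?thesis using False
    by (simp add: indicator_fourier_def set_lebesgue_integral_eq_integral integral_unique)
qed (simp add: indicator_fourier_0)

text \<open>Expanding the squared modulus gives the quadratic form of the Gram matrix. The identity
  is stated over the complex numbers because the individual terms need not be real.\<close>

lemma L2S_norm_sq_trig_poly:
  assumes "S \<in> sets lebesgue" "S \<subseteq> {-pi..pi}"
  shows "complex_of_real (L2S_norm_sq S (\<lambda>t. \<Sum>m\<in>F. c m * cis (of_int m * t)))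
       = (\<Sum>m\<in>F. \<Sum>n\<in>F. c m * cnj (c n) * indicator_fourier S (m - n))"
proof -
  have int: "set_integrable lebesgue S (\<lambda>t. c m * cnj (c n) * cis (of_int (m - n) * t))" for m n
    by (intro set_integrable_continuous_bounded_set[OF assms] continuous_intros)
  have "complex_of_real ((cmod (\<Sum>m\<in>F. c m * cis (of_int m * t)))\<^sup>2)
      = (\<Sum>m\<in>F. \<Sum>n\<in>F. c m * cnj (c n) * cis (of_int (m - n) * t))" for t
  proof -
    have "cis (of_int (m - n) * t) = cis (of_int m * t) * cnj (cis (of_int n * t))" for m n
      by (simp add: cis_cnj cis_mult left_diff_distrib)
    thus ?thesis unfolding complex_norm_square by (simp add: sum_product mult_ac)
  qed
  hence "complex_of_real (LINT t:S|lebesgue. (cmod (\<Sum>m\<in>F. c m * cis (of_int m * t)))\<^sup>2)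
      = (LINT t:S|lebesgue. (\<Sum>m\<in>F. \<Sum>n\<in>F. c m * cnj (c n) * cis (of_int (m - n) * t)))"
    by (simp flip: set_integral_complex_of_real)
  also have "\<dots> = (\<Sum>m\<in>F. LINT t:S|lebesgue. (\<Sum>n\<in>F. c m * cnj (c n) * cis (of_int (m - n) * t)))"
    by (intro set_integral_sum set_integrable_continuous_bounded_set[OF assms] continuous_intros)
  also have "\<dots> = (\<Sum>m\<in>F. \<Sum>n\<in>F. LINT t:S|lebesgue. c m * cnj (c n) * cis (of_int (m - n) * t))"
    by (intro sum.cong refl set_integral_sum int)
  also have "\<dots> = (\<Sum>m\<in>F. \<Sum>n\<in>F. c m * cnj (c n) * indicator_fourier S (m - n)) * (2 * pi)"
    by (simp add: indicator_fourier_def sum_distrib_right)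
  finally show ?thesis by (simp add: L2S_norm_sq_def)
qed

text \<open>Bessel's inequality, read off from \<open>\<integral> |1 - P|\<^sup>2 \<ge> 0\<close> over \<open>S\<close>,
  where \<open>P\<close> is the partial Fourier sum over \<open>F\<close> of the indicator function of \<open>S\<close>.\<close>

lemma indicator_fourier_bessel:
  assumes S: "S \<in> sets lebesgue" "S \<subseteq> {-pi..pi}" and F: "finite F"
  shows "(\<Sum>m\<in>F. (cmod (indicator_fourier S m))\<^sup>2) \<le> measure lebesgue S / (2 * pi)"
proof -
  let ?b = "indicator_fourier S"
  have cnj_mult_self: "cnj z * z = of_real ((cmod z)\<^sup>2)" for z
    by (simp only: complex_norm_square mult.commute)
  \<comment> \<open>The conjugate undoes the sign convention of \<open>indicator_fourier\<close>:
    \<open>cnj (?b m)\<close> is the classical coefficient at \<open>m\<close>.\<close>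
  define P where "P t = (\<Sum>m\<in>F. cnj (?b m) * cis (of_int m * t))" for t
  define \<sigma> where "\<sigma> = (\<Sum>m\<in>F. (cmod (?b m))\<^sup>2)"
  have contP: "continuous_on UNIV P" unfolding P_def by (intro continuous_intros)
  note int = set_integrable_continuous_bounded_set[OF S]
  have T: "{-pi..pi} \<in> sets lebesgue" by simp
  \<comment> \<open>Passing to the full period makes orthonormality available for the quadratic
    term.\<close>
  have "(LINT t:S|lebesgue. (cmod (P t))\<^sup>2) \<le> (LINT t:{-pi..pi}|lebesgue. (cmod (P t))\<^sup>2)"
  proof -
    have "set_integrable lebesgue {-pi..pi} (\<lambda>t. (cmod (P t))\<^sup>2)"
      by (intro set_integrable_continuous_bounded_set[OF T order_refl] continuous_intros contP)
    moreover have "set_integrable lebesgue S (\<lambda>t. (cmod (P t))\<^sup>2)"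
      by (intro int continuous_intros contP)
    ultimately show ?thesis unfolding set_integrable_def set_lebesgue_integral_def
      using S(2) by (intro integral_mono) (auto simp: indicator_def)
  qed
  also have "\<dots> = 2 * pi * L2S_norm_sq {-pi..pi} P" by (simp add: L2S_norm_sq_def)
  also have "L2S_norm_sq {-pi..pi} P = \<sigma>"
  proof -
    have "complex_of_real (L2S_norm_sq {-pi..pi} P)
        = (\<Sum>m\<in>F. \<Sum>n\<in>F. cnj (?b m) * ?b n * (if m = n then 1 else 0))"
      unfolding P_def by (subst L2S_norm_sq_trig_poly) (auto simp: indicator_fourier_interval)
    also have "\<dots> = of_real \<sigma>"
      using F by (simp add: \<sigma>_def cnj_mult_self if_distrib cong: if_cong)
    finally show ?thesis by (simp only: of_real_eq_iff)
  qed
  finally have PS: "(LINT t:S|lebesgue. (cmod (P t))\<^sup>2) \<le> 2 * pi * \<sigma>" .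
  have "(LINT t:S|lebesgue. P t) = (\<Sum>m\<in>F. LINT t:S|lebesgue. cnj (?b m) * cis (of_int m * t))"
    unfolding P_def by (intro set_integral_sum int continuous_intros)
  also have "\<dots> = of_real (2 * pi * \<sigma>)"
  proof -
    have "(LINT t:S|lebesgue. cnj (?b m) * cis (of_int m * t)) = 2 * pi * (cnj (?b m) * ?b m)" for m
      by (simp add: indicator_fourier_def)
    thus ?thesis by (simp add: \<sigma>_def cnj_mult_self sum_distrib_left)
  qed
  finally have "Re (LINT t:S|lebesgue. P t) = 2 * pi * \<sigma>" by simp
  hence RP: "(LINT t:S|lebesgue. Re (P t)) = 2 * pi * \<sigma>"
    using int[OF contP] unfolding set_integrable_def set_lebesgue_integral_def
    by (simp flip: integral_Re)
  have one: "(LINT t:S|lebesgue. (1::real)) = measure lebesgue S"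
    by (simp add: set_lebesgue_integral_def)
  have "0 \<le> (LINT t:S|lebesgue. (1 - 2 * Re (P t)) + (cmod (P t))\<^sup>2)"
  proof -
    have "(1 - 2 * Re z) + (cmod z)\<^sup>2 = (cmod (1 - z))\<^sup>2" for z
      unfolding cmod_power2 by (simp add: power2_eq_square algebra_simps)
    thus ?thesis unfolding set_lebesgue_integral_def by simp
  qed
  also have "\<dots> = measure lebesgue S - 2 * (2 * pi * \<sigma>) + (LINT t:S|lebesgue. (cmod (P t))\<^sup>2)"
  proof -
    have "set_integrable lebesgue S (\<lambda>t. 1 :: real)"
      and "set_integrable lebesgue S (\<lambda>t. 2 * Re (P t))"
      and "set_integrable lebesgue S (\<lambda>t. (cmod (P t))\<^sup>2)"
      by (intro int continuous_intros contP)+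
    thus ?thesis by (simp only: set_integral_add set_integral_diff set_integral_mult_right RP one)
  qed
  \<comment> \<open>The linear term contributes \<open>- 4 * pi * \<sigma>\<close> and the quadratic
    one at most \<open>2 * pi * \<sigma>\<close>, so \<open>2 * pi * \<sigma>\<close> is at most the
    measure of \<open>S\<close>.\<close>
  finally show ?thesis using PS by (simp add: \<sigma>_def[symmetric] field_simps)
qed

section \<open>Riesz bounds from row sums\<close>

text \<open>The diagonal of the Gram matrix contributes \<open>d\<close> times the square sum of the
  coefficients, and Schur's test bounds the off-diagonal part by half of that.\<close>

lemma exp_riesz_sequence_if_rows_below:
  assumes S: "S \<in> sets lebesgue" "S \<subseteq> {-pi..pi}"
    and d: "d = measure lebesgue S / (2 * pi)" "d > 0"
    and rows: "\<And>F. finite F \<Longrightarrow> F \<subseteq> \<Lambda> \<Longrightarrow> rows_below (\<lambda>m. cmod (indicator_fourier S m)) (d / 2) F"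
  shows "exp_riesz_sequence S \<Lambda>"
proof -
  let ?b = "indicator_fourier S"
  have key: "\<bar>L2S_norm_sq S (\<lambda>t. \<Sum>m\<in>F. c m * exp (\<i> * complex_of_real (of_int m * t)))
      - d * (\<Sum>m\<in>F. (cmod (c m))\<^sup>2)\<bar> \<le> d / 2 * (\<Sum>m\<in>F. (cmod (c m))\<^sup>2)"
    (is "\<bar>?N - d * ?\<sigma>\<bar> \<le> _") if F: "finite F" "F \<subseteq> \<Lambda>" for F c
  proof -
    \<comment> \<open>Schur's test sums over full rows, whereas \<open>rows_below\<close> omits the
      diagonal; hence the zero diagonal.\<close>
    define r where "r m n = (if m = n then 0 else cmod (?b (m - n)))" for m n
    let ?g = "\<lambda>m n. c m * cnj (c n) * (if m = n then 0 else ?b (m - n))"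
    have "of_real ?N = (\<Sum>m\<in>F. \<Sum>n\<in>F. c m * cnj (c n) * ?b (m - n))"
      by (subst L2S_norm_sq_trig_poly[OF S, symmetric]) (simp add: cis_conv_exp)
    also have "\<dots> = (\<Sum>m\<in>F. \<Sum>n\<in>F. (if m = n then of_real (d * (cmod (c m))\<^sup>2) else 0) + ?g m n)"
    proof (intro sum.cong refl)
      fix m n
      have "c m * cnj (c m) = of_real ((cmod (c m))\<^sup>2)" by (rule complex_norm_square [symmetric])
      thus "c m * cnj (c n) * ?b (m - n) = (if m = n then of_real (d * (cmod (c m))\<^sup>2) else 0) + ?g m n"
        by (cases "m = n") (simp_all add: indicator_fourier_0 d(1))
    qed
    also have "\<dots> = of_real (d * ?\<sigma>) + (\<Sum>m\<in>F. \<Sum>n\<in>F. ?g m n)"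
      using F by (simp add: sum.distrib sum_distrib_left)
    finally have "of_real (?N - d * ?\<sigma>) = (\<Sum>m\<in>F. \<Sum>n\<in>F. ?g m n)" by simp
    from arg_cong[OF this, of cmod]
    have "\<bar>?N - d * ?\<sigma>\<bar> = cmod (\<Sum>m\<in>F. \<Sum>n\<in>F. ?g m n)" by (simp only: norm_of_real)
    also have "\<dots> \<le> (\<Sum>m\<in>F. \<Sum>n\<in>F. r m n * (cmod (c m) * cmod (c n)))"
      by (intro sum_norm_le) (auto simp: r_def norm_mult mult_ac)
    also have "\<dots> \<le> d / 2 * ?\<sigma>"
    proof (rule schur_test_symmetric)
      show "r m n = r n m" for m n
        using indicator_fourier_uminus[of S "m - n"] by (simp add: r_def)
      show "(\<Sum>n\<in>F. r m n) \<le> d / 2" if "m \<in> F" for m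
      proof -
        have "(\<Sum>n\<in>F. r m n) = (\<Sum>n\<in>F - {m}. cmod (?b (m - n)))"
          using that F by (subst sum.remove[of F m]) (auto simp: r_def intro!: sum.cong)
        thus ?thesis using rows[OF F] that by (auto simp: rows_below_def less_imp_le)
      qed
    qed (simp add: r_def)
    finally show ?thesis .
  qed
  show ?thesis
    unfolding exp_riesz_sequence_def
  \<comment> \<open>The estimate \<open>key\<close> gives the constants \<open>d / 2\<close> and
    \<open>3 * d / 2\<close>; the upper one is rounded up to \<open>2 * d\<close>.\<close>
  proof (rule exI[of _ "d / 2"], rule exI[of _ "2 * d"], intro conjI allI impI)
    fix F and c :: "int \<Rightarrow> complex" assume F: "finite F \<and> F \<subseteq> \<Lambda>"
    have "0 \<le> d * (\<Sum>m\<in>F. (cmod (c m))\<^sup>2)" using d by (intro mult_nonneg_nonneg sum_nonneg) auto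
    with key[OF conjunct1[OF F] conjunct2[OF F], of c]
    show "d / 2 * (\<Sum>m\<in>F. (cmod (c m))\<^sup>2)
           \<le> L2S_norm_sq S (\<lambda>t. \<Sum>m\<in>F. c m * exp (\<i> * complex_of_real (of_int m * t)))"
     and "L2S_norm_sq S (\<lambda>t. \<Sum>m\<in>F. c m * exp (\<i> * complex_of_real (of_int m * t)))
           \<le> 2 * d * (\<Sum>m\<in>F. (cmod (c m))\<^sup>2)"
      by (simp_all only: abs_le_iff mult.assoc times_divide_eq_left) linarith+
  qed (use d in auto)
qed

theorem theorem2:
  fixes S :: "real set"
  assumes "S \<in> sets lebesgue"
    and "S \<subseteq> {-pi..<pi}"
    and "emeasure lebesgue S > 0"
  shows "\<exists>\<Lambda> :: int set.
           (\<exists>C :: real. C > 0 \<and>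
              (\<forall>N0 :: nat. \<exists>N :: nat. N \<ge> N0 \<and>
                 (\<exists>(M :: int) (l :: nat). l \<ge> 1 \<and> real l \<le> C * real N \<and>
                    {M + int k * int l | k. k \<in> {1..N}} \<subseteq> \<Lambda>)))
         \<and> exp_riesz_sequence S \<Lambda>"
proof -
  have S: "S \<subseteq> {-pi..pi}" using assms(2) by auto
  define d where "d = measure lebesgue S / (2 * pi)"
  \<comment> \<open>Finite measure is what carries positivity from \<open>emeasure\<close> to
    \<open>measure\<close>, since \<open>measure\<close> is 0 on sets of infinite measure.\<close>
  have "S \<in> lmeasurable" using assms(1) S by (intro bounded_set_imp_lmeasurable bounded_subset[OF bounded_closed_interval])
  hence "emeasure lebesgue S = ennreal (measure lebesgue S)"
    by (intro emeasure_eq_ennreal_measure) (auto simp: fmeasurable_def)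
  hence "d > 0" using assms(3) by (simp add: d_def)
  let ?a = "\<lambda>m. cmod (indicator_fourier S m)"
  have "\<exists>\<Lambda>. (\<forall>K. \<exists>N\<ge>K. N \<ge> 1 \<and> (\<exists>M. {M + int k * int N | k. k \<in> {1..N}} \<subseteq> \<Lambda>))
      \<and> (\<forall>F. finite F \<and> F \<subseteq> \<Lambda> \<longrightarrow> rows_below ?a (d / 2) F)"
  proof (rule exists_spectrum_rows_below)
    show "(\<Sum>m\<in>F. (?a m)\<^sup>2) \<le> d" if "finite F" for F
      unfolding d_def using assms(1) S that by (rule indicator_fourier_bessel)
  qed (use \<open>d > 0\<close> in \<open>simp_all add: indicator_fourier_uminus\<close>)
  then obtain \<Lambda> where progs: "\<forall>K. \<exists>N\<ge>K. N \<ge> 1 \<and> (\<exists>M. {M + int k * int N | k. k \<in> {1..N}} \<subseteq> \<Lambda>)"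
    and rows: "\<forall>F. finite F \<and> F \<subseteq> \<Lambda> \<longrightarrow> rows_below ?a (d / 2) F"
    by (elim exE conjE)
  have "exp_riesz_sequence S \<Lambda>"
    by (rule exp_riesz_sequence_if_rows_below[OF assms(1) S d_def \<open>d > 0\<close>]) (use rows in simp)
  \<comment> \<open>Step and length of the progressions coincide, so \<open>C = 1\<close>
    serves.\<close>
  moreover have "\<exists>N\<ge>N0. \<exists>M (l::nat). l \<ge> 1 \<and> real l \<le> 1 * real N \<and>
      {M + int k * int l | k. k \<in> {1..N}} \<subseteq> \<Lambda>" for N0
  proof -
    obtain N M where "N \<ge> N0" "N \<ge> 1" "{M + int k * int N | k. k \<in> {1..N}} \<subseteq> \<Lambda>"
      using spec[OF progs, of N0] by (elim exE conjE)
    thus ?thesis by (intro exI[of _ N] exI[of _ M] conjI) simp_all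
  qed
  ultimately show ?thesis by (intro exI[of _ \<Lambda>] conjI exI[of _ "1 :: real"] allI) simp_all
qed

end
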